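(* Let $L$ be a complete algebraic lattice. Then $a.c.o.(L)$ is a complete lattice. For a family $(\phi_i \mid i\in I)$ with $\phi_i\in a.c.o.(L)$ and $x\in L$, the meet and join of the family in $a.c.o.(L)$ are given by $$\left(\bigwedge_{i\in I}\phi_i\right)(x)=\bigvee_{k\le_c x}\left(\bigwedge_{i\in I}\phi_i(k)\right)\quad\text{and}\quad \left(\bigvee_{i\in I}\phi_i\right)(x)=\bigvee_{n\ge 0,\ j\in I^n}\phi_{j_1}\phi_{j_2}\cdots\phi_{j_n}(x),$$ where the meets and joins on the right-hand sides are taken in $L$.
   Context: An element $c$ of a complete lattice $L$ is compact if $c\le\bigvee_{i\in I}x_i$ implies $c\le\bigvee_{i\in F}x_i$ for some finite $F\subseteq I$. $C(L)$ denotes the set of compact elements, and $k\le_c x$ means $k\in C(L)$ and $k\le x$. $L$ is algebraic if every element is a join of compact elements. A closure operator on $L$ is a map $\phi:L\to L$ such that $a\le\phi(a)$, $\phi(\phi(a))=\phi(a)$, and $a\le b$ implies $\phi(a)\le\phi(b)$, for all $a,b\in L$. A map $\phi:L\to L$ is finitary if $\phi(x)=\bigvee_{k\le_c x}\phi(k)$ for all $x\in L$. $a.c.o.(L)$ (the algebraic closure operators) is the set of finitary closure operators on $L$, ordered by $\phi_1\le\phi_2$ iff $\phi_1(x)\le\phi_2(x)$ for all $x\in L$. Juxtaposition of operators denotes composition; for $n=0$ the empty composite is the identity map. *)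

theory Defs
  imports "HOL-Algebra.Complete_Lattice"
begin

definition (in Complete_Lattices.complete_lattice) compact_element :: "'a \<Rightarrow> bool" where
  "compact_element c \<longleftrightarrow>
     (\<forall>X. c \<le> Sup X \<longrightarrow> (\<exists>F. finite F \<and> F \<subseteq> X \<and> c \<le> Sup F))"

definition compacts_below :: "'a::complete_lattice \<Rightarrow> 'a set" where
  "compacts_below x = {k. compact_element k \<and> k \<le> x}"

class algebraic_lattice = complete_lattice +
  assumes algebraic: "\<exists>K. (\<forall>k\<in>K. compact_element k) \<and> x = Sup K"

definition closure_operator :: "('a::order \<Rightarrow> 'a) \<Rightarrow> bool" where
  "closure_operator \<phi> \<longleftrightarrow>
     (\<forall>a. a \<le> \<phi> a) \<and> (\<forall>a. \<phi> (\<phi> a) = \<phi> a) \<and> (\<forall>a b. a \<le> b \<longrightarrow> \<phi> a \<le> \<phi> b)"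

definition finitary :: "('a::complete_lattice \<Rightarrow> 'a) \<Rightarrow> bool" where
  "finitary \<phi> \<longleftrightarrow> (\<forall>x. \<phi> x = Sup (\<phi> ` compacts_below x))"

text \<open>The lattice \<open>L\<close> is a type, but the algebraic closure operators on it form a subset of a
  function type, so their pointwise order is given as an ordered structure with a carrier. Meets and
  joins in this structure are therefore taken among algebraic closure operators only; they are not
  the pointwise \<open>Inf\<close> and \<open>Sup\<close> of the function type.\<close>

definition aco :: "('a::complete_lattice \<Rightarrow> 'a) gorder" where
  "aco = \<lparr>carrier = {\<phi>. finitary \<phi> \<and> closure_operator \<phi>}, eq = (=),
          le = (\<lambda>\<phi>\<^sub>1 \<phi>\<^sub>2. \<forall>x. \<phi>\<^sub>1 x \<le> \<phi>\<^sub>2 x)\<rparr>"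

text \<open>A tuple \<open>j \<in> I\<^sup>n\<close> is a list of length \<open>n\<close> over \<open>I\<close>. For such a list,
  \<open>foldr \<phi> [j\<^sub>1, \<dots>, j\<^sub>n] x = \<phi> j\<^sub>1 (\<phi> j\<^sub>2 (\<dots> (\<phi> j\<^sub>n x)))\<close>; the empty list gives \<open>x\<close>.\<close>

definition tuples :: "'i set \<Rightarrow> nat \<Rightarrow> 'i list set" where
  "tuples I n = {js. length js = n \<and> set js \<subseteq> I}"

end

theory Submission
  imports Defs
begin

text \<open>A compact element below a directed join lies below one of its members. Hence a monotone map
  is finitary iff every compact element below \<open>\<phi> x\<close> is already below \<open>\<phi> k\<close> for a compact \<open>k \<le> x\<close>.
  In this form the property passes to composites and to joins of directed families. For the meet,
  the family \<open>\<Sqinter>\<^sub>i \<phi>\<^sub>i k\<close> with \<open>k\<close> compact below \<open>x\<close> is directed; for the join, so is the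
  family of values at \<open>x\<close> of finite composites, as closure operators are inflationary. So a compact
  element below the formula evaluated at \<open>x\<close> is below a single member of the family, which
  reduces idempotence to that of the \<open>\<phi>\<^sub>i\<close> and to concatenation of composites, respectively.\<close>

section \<open>Compact elements, directed joins and algebraicity\<close>

lemma finite_directed_upper_bound:
  fixes D :: "'a::complete_lattice set"
  assumes "finite F" "F \<subseteq> D" "D \<noteq> {}"
    and dir: "\<And>a b. a \<in> D \<Longrightarrow> b \<in> D \<Longrightarrow> \<exists>c\<in>D. a \<le> c \<and> b \<le> c"
  shows "\<exists>d\<in>D. Sup F \<le> d"
  using assms(1,2)
proof (induction F)
  case empty
  then show ?case using \<open>D \<noteq> {}\<close> by auto
next
  case (insert a F)
  then obtain d where "d \<in> D" "Sup F \<le> d" by auto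
  moreover obtain c where "c \<in> D" "a \<le> c" "d \<le> c"
    using dir insert.prems \<open>d \<in> D\<close> by blast
  ultimately show ?case
    by (metis Sup_insert le_supI order_trans)
qed

lemma compact_le_directed_Sup:
  fixes D :: "'a::complete_lattice set"
  assumes "compact_element k" "k \<le> Sup D" "D \<noteq> {}"
    and dir: "\<And>a b. a \<in> D \<Longrightarrow> b \<in> D \<Longrightarrow> \<exists>c\<in>D. a \<le> c \<and> b \<le> c"
  obtains d where "d \<in> D" "k \<le> d"
proof -
  obtain F where F: "finite F" "F \<subseteq> D" "k \<le> Sup F"
    using assms(1,2) unfolding compact_element_def by blast
  from finite_directed_upper_bound[OF F(1,2) \<open>D \<noteq> {}\<close> dir]
  show thesis using F(3) that order_trans by blast
qed

lemma compact_element_bot: "compact_element (bot :: 'a::complete_lattice)"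
  unfolding compact_element_def by (metis bot_least empty_subsetI finite.emptyI)

lemma compact_element_sup:
  fixes a b :: "'a::complete_lattice"
  assumes "compact_element a" "compact_element b"
  shows "compact_element (sup a b)"
  unfolding compact_element_def
proof (intro allI impI)
  fix X assume "sup a b \<le> Sup X"
  then obtain F G where "finite F" "F \<subseteq> X" "a \<le> Sup F" "finite G" "G \<subseteq> X" "b \<le> Sup G"
    using assms unfolding compact_element_def by (meson le_supE)
  then show "\<exists>F. finite F \<and> F \<subseteq> X \<and> sup a b \<le> Sup F"
    by (intro exI[of _ "F \<union> G"]) (auto simp: Sup_union_distrib intro: le_supI1 le_supI2)
qed

lemma bot_in_compacts_below: "bot \<in> compacts_below x"
  by (simp add: compacts_below_def compact_element_bot)

lemma sup_in_compacts_below: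
  "a \<in> compacts_below x \<Longrightarrow> b \<in> compacts_below x \<Longrightarrow> sup a b \<in> compacts_below x"
  by (simp add: compacts_below_def compact_element_sup)

text \<open>Any set of compact elements with join \<open>x\<close> lies inside
  \<open>compacts_below x\<close>. This is where algebraicity enters.\<close>

lemma Sup_compacts_below: "Sup (compacts_below x) = (x :: 'a::algebraic_lattice)"
proof (rule antisym)
  show "Sup (compacts_below x) \<le> x"
    by (rule Sup_least) (simp add: compacts_below_def)
  obtain K where "\<forall>k\<in>K. compact_element k" "x = Sup K" using algebraic by blast
  then show "x \<le> Sup (compacts_below x)"
    unfolding compacts_below_def
    by (metis (mono_tags, lifting) Sup_subset_mono Sup_upper mem_Collect_eq subsetI)
qed

lemma le_if_compacts_le:
  fixes x y :: "'a::algebraic_lattice"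
  assumes "\<And>k. k \<in> compacts_below x \<Longrightarrow> k \<le> y"
  shows "x \<le> y"
  using assms Sup_least Sup_compacts_below by metis

text \<open>\<open>compacts_below x\<close> contains \<open>bot\<close> and is closed under binary
  joins, so its image under a monotone map is directed.\<close>

lemma compact_le_SUP_compacts_below:
  fixes f :: "'a::complete_lattice \<Rightarrow> 'a"
  assumes "mono f" "compact_element k" "k \<le> (SUP c\<in>compacts_below x. f c)"
  obtains c where "c \<in> compacts_below x" "k \<le> f c"
proof -
  obtain d where "d \<in> f ` compacts_below x" "k \<le> d"
  proof (rule compact_le_directed_Sup[OF assms(2,3)])
    show "f ` compacts_below x \<noteq> {}" using bot_in_compacts_below by blast
  next
    fix a b assume "a \<in> f ` compacts_below x" "b \<in> f ` compacts_below x"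
    then obtain a' b' where "a' \<in> compacts_below x" "a = f a'" "b' \<in> compacts_below x" "b = f b'"
      by blast
    then show "\<exists>c\<in>f ` compacts_below x. a \<le> c \<and> b \<le> c"
      using \<open>mono f\<close> sup_in_compacts_below[of a' x b']
      by (intro bexI[of _ "f (sup a' b')"]) (auto intro: monoD)
  qed
  then show thesis using that by blast
qed

section \<open>Finitary maps\<close>

lemma finitary_iff:
  fixes f :: "'a::algebraic_lattice \<Rightarrow> 'a"
  assumes "mono f"
  shows "finitary f \<longleftrightarrow> (\<forall>x. \<forall>k\<in>compacts_below (f x). \<exists>c\<in>compacts_below x. k \<le> f c)"
proof
  assume fin: "finitary f"
  show "\<forall>x. \<forall>k\<in>compacts_below (f x). \<exists>c\<in>compacts_below x. k \<le> f c"
  proof (intro allI ballI)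
    fix x k assume "k \<in> compacts_below (f x)"
    then have "compact_element k" "k \<le> f x" by (simp_all add: compacts_below_def)
    moreover have "f x = (SUP c\<in>compacts_below x. f c)"
      using fin unfolding finitary_def by (rule spec)
    ultimately show "\<exists>c\<in>compacts_below x. k \<le> f c"
      using compact_le_SUP_compacts_below[OF assms] by metis
  qed
next
  assume R: "\<forall>x. \<forall>k\<in>compacts_below (f x). \<exists>c\<in>compacts_below x. k \<le> f c"
  show "finitary f"
    unfolding finitary_def
  proof (intro allI antisym)
    fix x
    show "f x \<le> Sup (f ` compacts_below x)"
    proof (rule le_if_compacts_le)
      fix k assume "k \<in> compacts_below (f x)"
      then obtain c where "c \<in> compacts_below x" "k \<le> f c" using R by blast
      then show "k \<le> Sup (f ` compacts_below x)" by (rule SUP_upper2)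
    qed
    show "Sup (f ` compacts_below x) \<le> f x"
      by (rule SUP_least) (use \<open>mono f\<close> in \<open>auto simp: compacts_below_def intro: monoD\<close>)
  qed
qed

text \<open>The witness that the criterion yields for \<open>f\<close> is itself compact and below
  \<open>g x\<close>, so the criterion applies again, to \<open>g\<close>.\<close>

lemma finitary_comp:
  fixes f g :: "'a::algebraic_lattice \<Rightarrow> 'a"
  assumes "mono f" "mono g" "finitary f" "finitary g"
  shows "finitary (f \<circ> g)"
proof -
  have "mono (f \<circ> g)" using assms by (simp add: mono_def)
  moreover have "\<exists>c\<in>compacts_below x. k \<le> f (g c)" if k: "k \<in> compacts_below (f (g x))" for x k
  proof -
    obtain d where d: "d \<in> compacts_below (g x)" "k \<le> f d"
      using k assms(1,3) finitary_iff by blast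
    then obtain c where "c \<in> compacts_below x" "d \<le> g c"
      using assms(2,4) finitary_iff by blast
    then show ?thesis using d \<open>mono f\<close> by (meson monoD order_trans)
  qed
  ultimately show ?thesis by (simp add: finitary_iff)
qed

lemma finitary_id: "finitary (id :: 'a::algebraic_lattice \<Rightarrow> 'a)"
  by (simp add: finitary_def Sup_compacts_below)

text \<open>Reduces both halves of the meet property to compact arguments, where the candidate meet
  is the pointwise infimum.\<close>

lemma finitary_le_if_compacts_le:
  assumes "finitary f" "mono g" "\<And>k. compact_element k \<Longrightarrow> f k \<le> g k"
  shows "f x \<le> g x"
proof -
  have "f x = (SUP k\<in>compacts_below x. f k)" using assms(1) unfolding finitary_def by (rule spec)
  also have "\<dots> \<le> g x"
  proof (rule SUP_least)
    fix k assume "k \<in> compacts_below x"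
    then have "f k \<le> g k" "g k \<le> g x"
      using assms(2,3) by (auto simp: compacts_below_def dest: monoD)
    then show "f k \<le> g x" by (rule order_trans)
  qed
  finally show ?thesis .
qed

section \<open>The order on algebraic closure operators, and its meets\<close>

lemma carrier_aco: "f \<in> carrier aco \<longleftrightarrow> finitary f \<and> closure_operator f"
  by (simp add: aco_def)

lemma le_aco: "f \<sqsubseteq>\<^bsub>aco\<^esub> g \<longleftrightarrow> (\<forall>x. f x \<le> g x)"
  by (simp add: aco_def)

lemma partial_order_aco: "partial_order aco"
  by unfold_locales (auto simp: aco_def fun_eq_iff intro: antisym order_trans)

lemma closure_operatorI:
  assumes "mono f" "\<And>x. x \<le> f x" "\<And>x. f (f x) \<le> f x"
  shows "closure_operator f"
  using assms by (auto simp: closure_operator_def mono_def intro: antisym)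

lemma closure_operator_mono: "closure_operator f \<Longrightarrow> mono f"
  by (simp add: closure_operator_def mono_def)

text \<open>The pointwise infimum need not be finitary. The formula keeps its values at compact
  elements and extends them to all of the lattice by joins.\<close>

lemma greatest_Lower_aco:
  fixes \<phi> :: "'i \<Rightarrow> 'a::algebraic_lattice \<Rightarrow> 'a"
  assumes "\<forall>i\<in>I. \<phi> i \<in> carrier aco"
  shows "greatest aco (\<lambda>x. SUP k\<in>compacts_below x. INF i\<in>I. \<phi> i k) (Lower aco (\<phi> ` I))"
proof -
  define m where "m k = (INF i\<in>I. \<phi> i k)" for k
  define \<psi> where "\<psi> x = (SUP k\<in>compacts_below x. m k)" for x
  have cl: "closure_operator (\<phi> i)" and fin: "finitary (\<phi> i)" if "i \<in> I" for i
    using assms that by (auto simp: carrier_aco)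
  have m_mono: "mono m"
    unfolding m_def by (intro monoI INF_superset_mono order_refl) (meson cl closure_operator_mono monoD)
  have \<psi>_mono: "mono \<psi>"
    unfolding \<psi>_def by (rule monoI, rule SUP_subset_mono) (auto simp: compacts_below_def)
  \<comment> \<open>A compact \<open>k\<close> is the largest member of
    \<open>compacts_below k\<close>, so the monotone \<open>m\<close> attains the join
    there.\<close>
  have \<psi>_compact: "\<psi> k = m k" if "compact_element k" for k
    unfolding \<psi>_def using that m_mono
    by (intro antisym SUP_least SUP_upper) (auto simp: compacts_below_def mono_def)
  have "finitary \<psi>"
    unfolding finitary_def
  proof
    fix x
    have "\<psi> ` compacts_below x = m ` compacts_below x"
      by (rule image_cong) (auto simp: compacts_below_def \<psi>_compact)
    then show "\<psi> x = Sup (\<psi> ` compacts_below x)" by (simp add: \<psi>_def[of x])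
  qed
  moreover have "closure_operator \<psi>"
  proof (rule closure_operatorI[OF \<psi>_mono])
    fix x
    have m_infl: "k \<le> m k" for k
      unfolding m_def using cl by (auto simp: closure_operator_def intro: INF_greatest)
    show "x \<le> \<psi> x"
      unfolding \<psi>_def by (rule le_if_compacts_le) (erule SUP_upper2, rule m_infl)
    show "\<psi> (\<psi> x) \<le> \<psi> x"
      unfolding \<psi>_def[of "\<psi> x"]
    proof (rule SUP_least)
      fix k assume "k \<in> compacts_below (\<psi> x)"
      then have "compact_element k" "k \<le> (SUP c\<in>compacts_below x. m c)"
        by (auto simp: compacts_below_def \<psi>_def)
      then obtain c where c: "c \<in> compacts_below x" "k \<le> m c"
        using compact_le_SUP_compacts_below[OF m_mono] by metis
      \<comment> \<open>Idempotence of each \<open>\<phi> i\<close> is used here: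
        \<open>k \<le> \<phi> i c\<close> gives
        \<open>\<phi> i k \<le> \<phi> i (\<phi> i c) = \<phi> i c\<close>. The same
        \<open>c\<close> serves all \<open>i\<close>, so the infimum can be taken
        afterwards.\<close>
      have "\<phi> i k \<le> \<phi> i c" if i: "i \<in> I" for i
      proof -
        have "k \<le> \<phi> i c" using c(2) i unfolding m_def by (simp add: le_INF_iff)
        then show ?thesis using cl[OF i] unfolding closure_operator_def by metis
      qed
      then have "m k \<le> m c" unfolding m_def by (auto intro: INF_mono)
      then show "m k \<le> \<psi> x" unfolding \<psi>_def using c(1) by (rule SUP_upper2[rotated])
    qed
  qed
  ultimately have "\<psi> \<in> carrier aco" by (simp add: carrier_aco)
  moreover have "\<psi> x \<le> \<phi> i x" if "i \<in> I" for i x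
    using \<open>finitary \<psi>\<close> closure_operator_mono[OF cl[OF that]]
    by (rule finitary_le_if_compacts_le)
       (use that in \<open>auto simp: \<psi>_compact m_def intro: INF_lower\<close>)
  moreover have "\<chi> x \<le> \<psi> x"
    if "finitary \<chi>" "\<forall>i\<in>I. \<forall>x. \<chi> x \<le> \<phi> i x" for \<chi> x
    using that(1) \<psi>_mono
    by (rule finitary_le_if_compacts_le)
       (use that(2) in \<open>auto simp: \<psi>_compact m_def intro: INF_greatest\<close>)
  ultimately have "greatest aco \<psi> (Lower aco (\<phi> ` I))"
    using cl fin by (auto simp: greatest_def Lower_def le_aco carrier_aco)
  then show ?thesis by (simp add: \<psi>_def[abs_def] m_def)
qed

section \<open>Joins as suprema of finite composites\<close>

lemma SUP_tuples: "(SUP n. SUP js\<in>tuples I n. f js) = (SUP js\<in>lists I. f js :: 'a::complete_lattice)"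
proof (rule antisym)
  show "(SUP n. SUP js\<in>tuples I n. f js) \<le> (SUP js\<in>lists I. f js)"
    by (intro SUP_least SUP_upper) (auto simp: tuples_def)
  show "(SUP js\<in>lists I. f js) \<le> (SUP n. SUP js\<in>tuples I n. f js)"
  proof (rule SUP_least)
    fix js assume "js \<in> lists I"
    then have "js \<in> tuples I (length js)" by (auto simp: tuples_def)
    then show "f js \<le> (SUP n. SUP js\<in>tuples I n. f js)"
      by (intro SUP_upper2[of "length js"] SUP_upper) simp_all
  qed
qed

text \<open>Finite composites are monotone, inflationary and finitary, but not idempotent in
  general; their join becomes idempotent because composites can be concatenated. For empty
  \<open>I\<close> only the empty list remains, giving the identity.\<close>

lemma least_Upper_aco:
  fixes \<phi> :: "'i \<Rightarrow> 'a::algebraic_lattice \<Rightarrow> 'a"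
  assumes "\<forall>i\<in>I. \<phi> i \<in> carrier aco"
  shows "least aco (\<lambda>x. SUP js\<in>lists I. foldr \<phi> js x) (Upper aco (\<phi> ` I))"
proof -
  define \<sigma> where "\<sigma> x = (SUP js\<in>lists I. foldr \<phi> js x)" for x
  have cl: "closure_operator (\<phi> i)" and fin: "finitary (\<phi> i)" if "i \<in> I" for i
    using assms that by (auto simp: carrier_aco)
  have foldr_mono: "mono (foldr \<phi> js)" if "js \<in> lists I" for js
    using that by (induction js) (auto simp: mono_def dest!: cl closure_operator_mono)
  have foldr_infl: "x \<le> foldr \<phi> js x" if "js \<in> lists I" for js x
    using that
  proof (induction js)
    case (Cons i js)
    then have "foldr \<phi> js x \<le> \<phi> i (foldr \<phi> js x)"
      using cl[of i] by (auto simp: closure_operator_def)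
    with Cons show ?case by auto
  qed simp
  have foldr_fin: "finitary (foldr \<phi> js)" if "js \<in> lists I" for js
    using that
  proof (induction js)
    case Nil
    show ?case using finitary_id by (simp add: id_def)
  next
    case (Cons i js)
    then show ?case
      using finitary_comp[of "\<phi> i" "foldr \<phi> js"] foldr_mono fin cl closure_operator_mono
      by (auto simp: comp_def)
  qed
  have le_\<sigma>: "foldr \<phi> js x \<le> \<sigma> x" if "js \<in> lists I" for js x
    unfolding \<sigma>_def using that by (rule SUP_upper)
  have \<sigma>_mono: "mono \<sigma>"
    unfolding \<sigma>_def using foldr_mono by (auto intro!: monoI SUP_mono dest: monoD)
  have compact_le_\<sigma>: "\<exists>js\<in>lists I. k \<le> foldr \<phi> js x" if "k \<in> compacts_below (\<sigma> x)" for k x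
  proof -
    have k: "compact_element k" "k \<le> Sup ((\<lambda>js. foldr \<phi> js x) ` lists I)"
      using that by (auto simp: compacts_below_def \<sigma>_def)
    obtain d where "d \<in> (\<lambda>js. foldr \<phi> js x) ` lists I" "k \<le> d"
    proof (rule compact_le_directed_Sup[OF k])
      show "(\<lambda>js. foldr \<phi> js x) ` lists I \<noteq> {}" by blast
    next
      fix a b assume "a \<in> (\<lambda>js. foldr \<phi> js x) ` lists I" "b \<in> (\<lambda>js. foldr \<phi> js x) ` lists I"
      then obtain js ls where *: "js \<in> lists I" "ls \<in> lists I" "a = foldr \<phi> js x" "b = foldr \<phi> ls x"
        by blast
      \<comment> \<open>The first bound is monotonicity of \<open>foldr \<phi> js\<close> applied to
        \<open>x \<le> foldr \<phi> ls x\<close>; the second is inflation by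
        \<open>foldr \<phi> js\<close> at the point \<open>foldr \<phi> ls x\<close>.\<close>
      then have "a \<le> foldr \<phi> (js @ ls) x" "b \<le> foldr \<phi> (js @ ls) x"
        using foldr_infl foldr_mono by (auto dest: monoD)
      then show "\<exists>c\<in>(\<lambda>js. foldr \<phi> js x) ` lists I. a \<le> c \<and> b \<le> c"
        using * by (meson append_in_lists_conv image_eqI)
    qed
    then show ?thesis by blast
  qed
  have "finitary \<sigma>"
    unfolding finitary_iff[OF \<sigma>_mono]
  proof (intro allI ballI)
    fix x k assume k: "k \<in> compacts_below (\<sigma> x)"
    then obtain js where js: "js \<in> lists I" "k \<le> foldr \<phi> js x" using compact_le_\<sigma> by blast
    then have "k \<in> compacts_below (foldr \<phi> js x)" using k by (simp add: compacts_below_def)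
    then obtain c where "c \<in> compacts_below x" "k \<le> foldr \<phi> js c"
      using foldr_fin[OF js(1)] finitary_iff[OF foldr_mono[OF js(1)]] by blast
    then show "\<exists>c\<in>compacts_below x. k \<le> \<sigma> c" using le_\<sigma>[OF js(1)] order_trans by blast
  qed
  moreover have "closure_operator \<sigma>"
  proof (rule closure_operatorI[OF \<sigma>_mono])
    fix x
    show "x \<le> \<sigma> x" using le_\<sigma>[of "[]"] by simp
    show "\<sigma> (\<sigma> x) \<le> \<sigma> x"
    proof (rule le_if_compacts_le)
      fix k assume k: "k \<in> compacts_below (\<sigma> (\<sigma> x))"
      then obtain js where js: "js \<in> lists I" "k \<le> foldr \<phi> js (\<sigma> x)" using compact_le_\<sigma> by blast
      then have "k \<in> compacts_below (foldr \<phi> js (\<sigma> x))" using k by (simp add: compacts_below_def)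
      \<comment> \<open>Finitariness of the outer composite replaces its argument
        \<open>\<sigma> x\<close> by one compact \<open>c\<close> below it, and a single composite
        at \<open>x\<close> then dominates \<open>c\<close>.\<close>
      then obtain c where c: "c \<in> compacts_below (\<sigma> x)" "k \<le> foldr \<phi> js c"
        using foldr_fin[OF js(1)] finitary_iff[OF foldr_mono[OF js(1)]] by blast
      then obtain ls where ls: "ls \<in> lists I" "c \<le> foldr \<phi> ls x" using compact_le_\<sigma> by blast
      have "k \<le> foldr \<phi> (js @ ls) x"
        using c(2) monoD[OF foldr_mono[OF js(1)] ls(2)] by simp
      also have "\<dots> \<le> \<sigma> x" using js(1) ls(1) by (intro le_\<sigma>) simp
      finally show "k \<le> \<sigma> x" .
    qed
  qed
  ultimately have "\<sigma> \<in> carrier aco" by (simp add: carrier_aco)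
  moreover have "\<phi> i x \<le> \<sigma> x" if "i \<in> I" for i x
    using le_\<sigma>[of "[i]"] that by simp
  moreover have "\<sigma> x \<le> \<chi> x"
    if \<chi>: "closure_operator \<chi>" "\<forall>i\<in>I. \<forall>x. \<phi> i x \<le> \<chi> x" for \<chi> x
    unfolding \<sigma>_def
  proof (rule SUP_least)
    \<comment> \<open>Each further factor \<open>\<phi> i\<close> is bounded by
      \<open>\<chi>\<close> and absorbed by idempotence of \<open>\<chi>\<close>.\<close>
    fix js assume "js \<in> lists I"
    then show "foldr \<phi> js x \<le> \<chi> x"
    proof (induction js)
      case Nil
      show ?case using \<chi>(1) by (simp add: closure_operator_def)
    next
      case (Cons i js)
      then have "\<phi> i (foldr \<phi> js x) \<le> \<phi> i (\<chi> x)"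
        using cl[of i] by (auto simp: closure_operator_def)
      also have "\<dots> \<le> \<chi> (\<chi> x)" using \<chi>(2) Cons by auto
      also have "\<dots> = \<chi> x" using \<chi>(1) by (simp add: closure_operator_def)
      finally show ?case by simp
    qed
  qed
  ultimately have "least aco \<sigma> (Upper aco (\<phi> ` I))"
    using cl fin by (auto simp: least_def Upper_def le_aco carrier_aco)
  then show ?thesis by (simp add: \<sigma>_def[abs_def])
qed

theorem theorem3p9:
  shows "complete_lattice (aco :: ('a::algebraic_lattice \<Rightarrow> 'a) gorder)
    \<and> (\<forall>(I :: 'i set) (\<phi> :: 'i \<Rightarrow> 'a \<Rightarrow> 'a) (x :: 'a).
         (\<forall>i\<in>I. \<phi> i \<in> carrier aco) \<longrightarrow>
           (\<Sqinter>\<^bsub>aco\<^esub> (\<phi> ` I)) x = (SUP k \<in> compacts_below x. INF i \<in> I. \<phi> i k) \<and>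
           (\<Squnion>\<^bsub>aco\<^esub> (\<phi> ` I)) x = (SUP n. SUP js \<in> tuples I n. foldr \<phi> js x))"
proof -
  interpret partial_order "aco :: ('a \<Rightarrow> 'a) gorder" by (rule partial_order_aco)
  have "complete_lattice (aco :: ('a \<Rightarrow> 'a) gorder)"
  proof
    fix A :: "('a \<Rightarrow> 'a) set" assume "A \<subseteq> carrier aco"
    \<comment> \<open>A set of operators is treated as a family indexed by itself.\<close>
    then have "\<forall>f\<in>A. id f \<in> carrier aco" by auto
    from least_Upper_aco[OF this] greatest_Lower_aco[OF this]
    show "\<exists>s. least aco s (Upper aco A)" "\<exists>s. greatest aco s (Lower aco A)" by auto
  qed
  moreover have "\<Sqinter>\<^bsub>aco\<^esub> (\<phi> ` I) = (\<lambda>x. SUP k\<in>compacts_below x. INF i\<in>I. \<phi> i k)"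
    "\<Squnion>\<^bsub>aco\<^esub> (\<phi> ` I) = (\<lambda>x. SUP js\<in>lists I. foldr \<phi> js x)"
    if "\<forall>i\<in>I. \<phi> i \<in> carrier aco" for I :: "'i set" and \<phi> :: "'i \<Rightarrow> 'a \<Rightarrow> 'a"
    \<comment> \<open>Meet and join in \<open>aco\<close> are defined by choice; uniqueness of
      greatest and least elements in a partial order identifies the chosen ones with the
      formulas.\<close>
    using greatest_Lower_aco[OF that] least_Upper_aco[OF that]
    unfolding inf_def sup_def by (blast intro: someI greatest_unique least_unique)+
  \<comment> \<open>\<open>SUP_tuples\<close> passes from \<open>lists I\<close>, which suits
    concatenation and induction, to the grading by length.\<close>
  ultimately show ?thesis by (simp add: SUP_tuples)
qed

end
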